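(* Consider the discretization and the hyperbolic stage 1 update $\mathbf u^n\mapsto\mathbf u^{n,1}$ described in the context, with time step $\tau>0$. Assume that $\mathbf u_i^n\in\mathcal A(b)$ for all $i\in\mathcal V$ and that $\tau\,\max_{i\in\mathcal V}\frac{2}{m_i}\sum_{j\in\mathcal V^*(i)}d^{1}_{ij}\le1$. Then: (i) $\mathbf u_i^{n,1}\in\mathcal A(b)$ for all $i\in\mathcal V$; (ii) the mapping $\mathbf u^n\mapsto\mathbf u^{n,1}$ is conservative: if the boundary contributions to the fluxes vanish (as specified in the context), then $\sum_im_i\rho_i^{n,1}=\sum_im_i\rho_i^n$, $\sum_im_i\mathbf m_i^{n,1}=\sum_im_i\mathbf m_i^n$, $\sum_im_iE_{\mathrm{tot},i}^{n,1}=\sum_im_iE_{\mathrm{tot},i}^n$, where all sums are over $i\in\mathcal V$.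
   Context: **States.** $d\in\{1,2,3\}$; states are $\mathbf u=(\rho,\mathbf m^{T},E_{\mathrm m},E_{\mathrm r})^{T}\in\mathbb R^{d+3}$; $\mathbf v=\mathbf m/\rho$, $e(\mathbf u)=\rho^{-1}E_{\mathrm m}-\frac12\|\mathbf v\|^2$, $E_{\mathrm{tot}}=E_{\mathrm m}+E_{\mathrm r}$, with $\|\cdot\|$ the Euclidean norm. Fix $b\ge0$. The cold curve is taken to be zero and the pressure positive: $\mathcal B(b)=\{\mathbf u:\rho>0,\ 1-b\rho>0,\ e(\mathbf u)>0\}$, $\mathcal A(b)=\{\mathbf u\in\mathcal B(b): E_{\mathrm r}>0\}$, and the pressure is a given function $p:\mathcal B(b)\to(0,\infty)$. **Discretization.** $\mathcal V$ is a finite index set, partitioned as $\mathcal V=\mathcal V^{\circ}\cup\mathcal V^{\partial}$ (interior/boundary). Each $i\in\mathcal V$ has a stencil $\mathcal V(i)\ni i$, with $j\in\mathcal V(i)$ iff $i\in\mathcal V(j)$; $\mathcal V^*(i)=\mathcal V(i)\setminus\{i\}$. Masses $m_i>0$ (diagonal low-order mass matrix); there is also an invertible symmetric matrix $(m_{ij})$ with $m_{ij}=0$ if $j\notin\mathcal V(i)$ and $m_i=\sum_{j\in\mathcal V(i)}m_{ji}$ (not otherwise used here). Vectors $\mathbf c_{ij}\in\mathbb R^d$ with $\mathbf c_{ij}=0$ if $j\notin\mathcal V(i)$, $\mathbf c_{ij}=-\mathbf c_{ji}$ whenever $i$ or $j$ is in $\mathcal V^\circ$, and $\sum_{j\in\mathcal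 V(i)}\mathbf c_{ij}=0$. For $\mathbf c_{ij}\ne0$, $\mathbf n_{ij}=\mathbf c_{ij}/\|\mathbf c_{ij}\|$; terms below multiplied by $\|\mathbf c_{ij}\|=0$ are zero. **Hyperbolic stage 1.** $\mathbb g(\mathbf u)\in\mathbb R^{(d+3)\times d}$ has rows $\rho\mathbf v^T$, $\mathbf v\otimes\mathbf m+p(\mathbf u)\mathbb I_d$, $(E_{\mathrm m}+p(\mathbf u))\mathbf v^T$, $E_{\mathrm r}\mathbf v^T$. Extended states $\hat{\mathbf u}=(\rho,\mathbf m^T,E_{\mathrm m},E_{\mathrm r},\Gamma)^T$; $\Theta(\mathbf u)=(\mathbf u^T,\Gamma(\mathbf u))^T$ with $\Gamma(\mathbf u)=\rho+p(\mathbf u)\frac{1-b\rho}{e(\mathbf u)}$; the extended flux $\hat{\mathbb g}(\hat{\mathbf u})$ has rows $\rho\mathbf v^T$, $\mathbf v\otimes\mathbf m+\hat p\,\mathbb I_d$, $(E_{\mathrm m}+\hat p)\mathbf v^T$, $E_{\mathrm r}\mathbf v^T$, $\Gamma\mathbf v^T$, with $\hat p=\frac{\Gamma-\rho}{1-b\rho}e$, $e=\rho^{-1}E_{\mathrm m}-\frac12\|\mathbf v\|^2$. For a unit vector $\mathbf n$, $\hat\lambda(\mathbf n,\mathbf u_L,\mathbf u_R)>0$ is any upper bound on the maximum wave speed of the Lax-entropic self-similar solution (possibly with vacuum) of $\partial_t\hat{\mathbf w}+\partial_x(\hat{\mathbb g}(\hat{\mathbf w})\mathbf n)=0$ with left/right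 data $\Theta(\mathbf u_L),\Theta(\mathbf u_R)$. For $j\in\mathcal V^*(i)$ set $d^1_{ij}=\max(\hat\lambda(\mathbf n_{ij},\mathbf u_i^n,\mathbf u_j^n)\|\mathbf c_{ij}\|,\ \hat\lambda(\mathbf n_{ji},\mathbf u_j^n,\mathbf u_i^n)\|\mathbf c_{ji}\|)$. The update is $$m_i\mathbf u_i^{n,1}=m_i\mathbf u_i^n+\tau\sum_{j\in\mathcal V(i)}\Big(-(\mathbb g(\mathbf u_j^n)+\mathbb g(\mathbf u_i^n))\mathbf c_{ij}+d^1_{ij}(\mathbf u_j^n-\mathbf u_i^n)\Big),\qquad i\in\mathcal V.$$ **Vanishing boundary contributions.** $\sum_{i\in\mathcal V^\partial}\sum_{j\in\mathcal V(i)\cap\mathcal V^\partial}(\mathbb g(\mathbf u_j^n)+\mathbb g(\mathbf u_i^n))\mathbf c_{ij}$ has vanishing $\rho$- and $\mathbf m$-components and vanishing sum of $E_{\mathrm m}$- and $E_{\mathrm r}$-components. *)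

theory Defs
  imports "HOL-Analysis.Analysis"
begin

section \<open>States\<close>

text \<open>A state is the tuple (density, momentum, mechanical energy, radiation energy); the product
  vector-space structure provides the linear operations on states.\<close>

type_synonym 'd state = "real \<times> (real^'d) \<times> real \<times> real"

definition rho :: "'d state \<Rightarrow> real" where "rho u = fst u"
definition mom :: "'d state \<Rightarrow> real^'d" where "mom u = fst (snd u)"
definition Em :: "'d state \<Rightarrow> real" where "Em u = fst (snd (snd u))"
definition Er :: "'d state \<Rightarrow> real" where "Er u = snd (snd (snd u))"
definition Etot :: "'d state \<Rightarrow> real" where "Etot u = Em u + Er u"

definition vel :: "('d::finite) state \<Rightarrow> real^'d" where
  "vel u = mom u /\<^sub>R rho u"

definition eint :: "('d::finite) state \<Rightarrow> real" where
  "eint u = Em u / rho u - (norm (vel u))\<^sup>2 / 2"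

definition B_set :: "real \<Rightarrow> (('d::finite) state) set" where
  "B_set b = {u. 0 < rho u \<and> 0 < 1 - b * rho u \<and> 0 < eint u}"

definition A_set :: "real \<Rightarrow> (('d::finite) state) set" where
  "A_set b = {u \<in> B_set b. 0 < Er u}"

section \<open>Fluxes\<close>

text \<open>The flux matrix, with pressure value \<open>P\<close>, applied to a vector \<open>c\<close>.\<close>

definition flux_with :: "real \<Rightarrow> ('d::finite) state \<Rightarrow> real^'d \<Rightarrow> 'd state" where
  "flux_with P u c =
    (rho u * (vel u \<bullet> c),
     ((\<chi> k l. vel u $ k * mom u $ l) + mat P) *v c,
     (Em u + P) * (vel u \<bullet> c),
     Er u * (vel u \<bullet> c))"

definition flux :: "(('d::finite) state \<Rightarrow> real) \<Rightarrow> 'd state \<Rightarrow> real^'d \<Rightarrow> 'd state" where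
  "flux p u c = flux_with (p u) u c"

text \<open>An extended state is a state together with its variable \<open>\<Gamma>\<close>.\<close>

type_synonym 'd ext = "'d state \<times> real"

definition Theta :: "real \<Rightarrow> (('d::finite) state \<Rightarrow> real) \<Rightarrow> 'd state \<Rightarrow> 'd ext" where
  "Theta b p u = (u, rho u + p u * (1 - b * rho u) / eint u)"

definition phat :: "real \<Rightarrow> ('d::finite) ext \<Rightarrow> real" where
  "phat b w = (snd w - rho (fst w)) / (1 - b * rho (fst w)) * eint (fst w)"

definition ext_flux :: "real \<Rightarrow> ('d::finite) ext \<Rightarrow> real^'d \<Rightarrow> 'd ext" where
  "ext_flux b w n = (flux_with (phat b w) (fst w) n, snd w * (vel (fst w) \<bullet> n))"

section \<open>Lax solutions of the extended Riemann problem\<close>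

text \<open>The extended system in direction \<open>n\<close> (a unit vector) is the system for a covolume gas with
  the transported adiabatic exponent \<open>\<gamma> = \<Gamma> / \<rho>\<close>.  Its squared sound speed is
  \<open>\<gamma> p / (\<rho> (1 - b \<rho>))\<close>, and its eigenvalues are \<open>v \<bullet> n - c\<close>, \<open>v \<bullet> n\<close> (repeated and
  linearly degenerate) and \<open>v \<bullet> n + c\<close>.  Positivity of \<open>e\<close>, \<open>\<Gamma> - \<rho>\<close> or \<open>E\<^sub>r\<close> is not part of
  the definition of the phase space.\<close>

definition sound2 :: "real \<Rightarrow> ('d::finite) ext \<Rightarrow> real" where
  "sound2 b w = (snd w / rho (fst w)) * phat b w / (rho (fst w) * (1 - b * rho (fst w)))"

definition hyperbolic :: "real \<Rightarrow> ('d::finite) ext \<Rightarrow> bool" where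
  "hyperbolic b w \<longleftrightarrow> 0 < rho (fst w) \<and> 0 < 1 - b * rho (fst w) \<and> 0 < sound2 b w"

definition ev1 :: "real \<Rightarrow> real^'d \<Rightarrow> ('d::finite) ext \<Rightarrow> real" where
  "ev1 b n w = vel (fst w) \<bullet> n - sqrt (sound2 b w)"
definition ev2 :: "real^'d \<Rightarrow> ('d::finite) ext \<Rightarrow> real" where
  "ev2 n w = vel (fst w) \<bullet> n"
definition ev3 :: "real \<Rightarrow> real^'d \<Rightarrow> ('d::finite) ext \<Rightarrow> real" where
  "ev3 b n w = vel (fst w) \<bullet> n + sqrt (sound2 b w)"

text \<open>Lax conditions for a jump of speed \<open>s\<close> from \<open>wm\<close> (left) to \<open>wp\<close> (right): a 1-shock,
  a contact discontinuity of the linearly degenerate field, or a 3-shock.\<close>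

definition lax_jump :: "real \<Rightarrow> real^'d \<Rightarrow> real \<Rightarrow> ('d::finite) ext \<Rightarrow> 'd ext \<Rightarrow> bool" where
  "lax_jump b n s wm wp \<longleftrightarrow> hyperbolic b wm \<and> hyperbolic b wp \<and>
    ((ev1 b n wp < s \<and> s < ev1 b n wm \<and> s < ev2 n wp) \<or>
     (ev2 n wm = s \<and> ev2 n wp = s) \<or>
     (ev3 b n wp < s \<and> s < ev3 b n wm \<and> ev2 n wm < s))"

text \<open>\<open>w\<close> is a function of the similarity variable \<open>\<xi> = x / t\<close>.  It is piecewise \<open>C\<^sup>1\<close>;
  on the smooth pieces \<open>\<partial>\<^sub>t w + \<partial>\<^sub>x f(w) = 0\<close> reads \<open>(f \<circ> w)' = \<xi> w'\<close>; at each of the finitely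
  many breakpoints the Rankine-Hugoniot relation holds and a nontrivial jump is Lax-admissible.
  At a breakpoint \<open>w\<close> takes its right limit.  Vacuum is the zero state, at which the flux
  vanishes too (HOL division by zero); the limits of \<open>f \<circ> w\<close> at the breakpoints are required
  explicitly because the flux is not continuous at vacuum.\<close>

definition lax_riemann_solution ::
  "real \<Rightarrow> real^'d \<Rightarrow> ('d::finite) ext \<Rightarrow> 'd ext \<Rightarrow> (real \<Rightarrow> 'd ext) \<Rightarrow> bool" where
  "lax_riemann_solution b n wL wR w \<longleftrightarrow>
    (let f = (\<lambda>z. ext_flux b z n) in
      (\<forall>\<xi>. w \<xi> = 0 \<or> hyperbolic b (w \<xi>)) \<and>
      (\<forall>\<^sub>F \<xi> in at_bot. w \<xi> = wL) \<and>
      (\<forall>\<^sub>F \<xi> in at_top. w \<xi> = wR) \<and>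
      (\<exists>S. finite S \<and>
        w C1_differentiable_on (- S) \<and>
        (\<forall>\<xi>\<in>- S. ((\<lambda>\<eta>. f (w \<eta>)) has_vector_derivative \<xi> *\<^sub>R vector_derivative w (at \<xi>)) (at \<xi>)) \<and>
        (\<forall>s\<in>S. \<exists>wm.
          (w \<longlongrightarrow> wm) (at_left s) \<and> ((\<lambda>\<eta>. f (w \<eta>)) \<longlongrightarrow> f wm) (at_left s) \<and>
          (w \<longlongrightarrow> w s) (at_right s) \<and> ((\<lambda>\<eta>. f (w \<eta>)) \<longlongrightarrow> f (w s)) (at_right s) \<and>
          f (w s) - f wm = s *\<^sub>R (w s - wm) \<and>
          (wm \<noteq> w s \<longrightarrow> lax_jump b n s wm (w s)))))"

text \<open>The wave speeds are the \<open>\<xi>\<close> near which \<open>w\<close> is not locally constant.\<close>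

definition wave_speeds :: "(real \<Rightarrow> 'a) \<Rightarrow> real set" where
  "wave_speeds w = {\<xi>. \<not> (\<forall>\<^sub>F \<eta> in nhds \<xi>. w \<eta> = w \<xi>)}"

text \<open>\<open>l\<close> bounds the maximum wave speed of the Lax solution, whose existence and uniqueness
  are classical and presupposed by speaking of this speed.\<close>

definition max_wave_speed_bound ::
  "real \<Rightarrow> real^'d \<Rightarrow> ('d::finite) ext \<Rightarrow> 'd ext \<Rightarrow> real \<Rightarrow> bool" where
  "max_wave_speed_bound b n wL wR l \<longleftrightarrow>
    (\<exists>w. lax_riemann_solution b n wL wR w \<and> (\<forall>\<xi>\<in>wave_speeds w. \<bar>\<xi>\<bar> \<le> l))"

section \<open>Graph viscosity\<close>

text \<open>For \<open>c i j = 0\<close> the first argument of \<open>lam\<close> is the zero vector, but the term is multiplied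
  by \<open>norm (c i j) = 0\<close>.\<close>

definition d1 ::
  "(real^'d \<Rightarrow> 'd state \<Rightarrow> 'd state \<Rightarrow> real) \<Rightarrow> ('v \<Rightarrow> 'v \<Rightarrow> real^('d::finite)) \<Rightarrow>
   ('v \<Rightarrow> 'd state) \<Rightarrow> 'v \<Rightarrow> 'v \<Rightarrow> real" where
  "d1 lam c u i j =
    max (lam (c i j /\<^sub>R norm (c i j)) (u i) (u j) * norm (c i j))
        (lam (c j i /\<^sub>R norm (c j i)) (u j) (u i) * norm (c j i))"

end

theory Submission
  imports Defs
begin

text \<open>
  Each summand of the update is a multiple of a bar state minus \<open>u i\<close>, so that under the CFL
  condition \<open>u1 i\<close> is a convex combination of \<open>u i\<close> and of bar states.  As the admissible set is
  convex (\<open>convex_A_set\<close>), assertion (i) reduces to the admissibility of the bar states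
  (\<open>bar_state_admissible\<close>).  The bar state is the average over \<open>[- l, l]\<close> of the state components
  of the Lax solution \<open>w\<close> of the extended Riemann problem, where \<open>l\<close> bounds the wave speeds.

  A self-similar solution is handled through \<open>G \<xi> = f (w \<xi>) - \<xi> w \<xi>\<close>.  The differential equation
  says \<open>G' = - w\<close>, and the Rankine-Hugoniot relation says that \<open>G\<close> is continuous across the
  breakpoints.  The density component \<open>q = \<rho> (v \<bullet> n - \<xi>)\<close> of \<open>G\<close> is therefore continuous and
  nonincreasing.  Where \<open>q\<close> vanishes there is vacuum, except at finitely many points.  To the left
  of that set (\<open>q > 0\<close>) and to its right (\<open>q < 0\<close>), the quotient of the \<open>X\<close>-component of \<open>G\<close> by
  \<open>q\<close> is constant for every quantity \<open>X\<close> advected with the velocity.  Hence \<open>E\<^sub>r / \<rho>\<close> and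
  \<open>\<Gamma> / \<rho>\<close> keep their values from the left or the right datum, and \<open>E\<^sub>r > 0\<close> and \<open>\<Gamma> > \<rho>\<close> hold
  wherever \<open>q \<noteq> 0\<close>.  Positivity of the squared sound speed then forces \<open>e > 0\<close>.  So \<open>w\<close> is
  admissible or vacuum off a finite set (\<open>admissible_off_finite\<close>).

  Admissibility is expressed by strict affine inequalities (\<open>A_set_iff\<close>), each of which passes to
  the average: for a linear \<open>\<phi>\<close> that is positive on admissible states, \<open>\<phi> (G (- l)) > \<phi> (G l)\<close>
  because the derivative \<open>- \<phi> w\<close> is nonpositive and not zero throughout.  The entropy conditions
  at the jumps play no role.

  Assertion (ii) is the cancellation of skew-symmetric terms in the double sum over the stencils
  (\<open>update_balance\<close>).
\<close>

section \<open>The admissible set\<close>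

text \<open>The mechanical energy in the frame moving with velocity \<open>a\<close>.  It is linear in the state;
  for positive density its minimum over \<open>a\<close>, attained at the velocity of the state, is the internal energy per volume.\<close>

definition energy_fun :: "real^'d \<Rightarrow> ('d::finite) state \<Rightarrow> real" where
  "energy_fun a u = Em u - mom u \<bullet> a + rho u * (a \<bullet> a) / 2"

lemma rho_linear: "linear (rho :: ('d::finite) state \<Rightarrow> real)"
  by (intro linearI) (auto simp: rho_def)

lemma mom_linear: "linear (mom :: ('d::finite) state \<Rightarrow> real^'d)"
  by (intro linearI) (auto simp: mom_def)

lemma Er_linear: "linear (Er :: ('d::finite) state \<Rightarrow> real)"
  by (intro linearI) (auto simp: Er_def)

lemma Etot_linear: "linear (Etot :: ('d::finite) state \<Rightarrow> real)"
  by (intro linearI) (auto simp: Etot_def Em_def Er_def algebra_simps)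

lemma energy_fun_linear: "linear (energy_fun a :: ('d::finite) state \<Rightarrow> real)"
  by (intro linearI)
     (auto simp: energy_fun_def Em_def rho_def mom_def inner_add_left algebra_simps add_divide_distrib)

lemma rho_0 [simp]: "rho 0 = 0"
  and mom_0 [simp]: "mom 0 = 0"
  by (simp_all add: rho_def mom_def)

lemma mom_eq_vel: "rho u \<noteq> 0 \<Longrightarrow> mom u = rho u *\<^sub>R vel u"
  by (simp add: vel_def)

lemma energy_fun_eq:
  assumes "rho u \<noteq> 0"
  shows "energy_fun a u = rho u * (eint u + (norm (vel u - a))\<^sup>2 / 2)"
proof -
  have "Em u = rho u * (eint u + (vel u \<bullet> vel u) / 2)"
    using assms by (simp add: eint_def power2_norm_eq_inner field_simps)
  then show ?thesis
    using assms
    by (simp add: energy_fun_def mom_eq_vel power2_norm_eq_inner inner_diff_left inner_diff_right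
        inner_commute algebra_simps add_divide_distrib diff_divide_distrib)
qed

text \<open>The nonlinear condition \<open>e > 0\<close> is replaced by a family of linear ones.\<close>

lemma A_set_iff:
  "u \<in> A_set b \<longleftrightarrow> 0 < rho u \<and> b * rho u < 1 \<and> 0 < Er u \<and> (\<forall>a. 0 < energy_fun a u)"
proof (cases "0 < rho u")
  case True
  have "0 < eint u \<longleftrightarrow> (\<forall>a. 0 < energy_fun a u)"
  proof
    assume "0 < eint u"
    then show "\<forall>a. 0 < energy_fun a u"
      using True by (simp add: energy_fun_eq add_pos_nonneg)
  next
    assume "\<forall>a. 0 < energy_fun a u"
    then have "0 < energy_fun (vel u) u" ..
    then show "0 < eint u"
      using True by (simp add: energy_fun_eq zero_less_mult_iff)
  qed
  with True show ?thesis by (auto simp: A_set_def B_set_def)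
qed (auto simp: A_set_def B_set_def)

lemma convex_positive_linear:
  fixes f :: "'a::real_vector \<Rightarrow> real"
  assumes "linear f"
  shows "convex {u. 0 < f u}"
  using convex_linear_vimage[OF assms convex_real_interval(3)[of 0]]
  by (simp add: vimage_def greaterThan_def)

lemma convex_A_set: "convex (A_set b :: ('d::finite) state set)"
proof -
  have "convex {u :: 'd state. b * rho u < 1}"
  proof -
    have "linear (\<lambda>u :: 'd state. b * rho u)"
      by (intro linearI) (auto simp: rho_def algebra_simps)
    from convex_linear_vimage[OF this convex_real_interval(4)[of 1]]
    show ?thesis by (simp add: vimage_def lessThan_def)
  qed
  moreover have "A_set b = {u. 0 < rho u} \<inter> {u. b * rho u < 1} \<inter> {u. 0 < Er u} \<inter>
      (\<Inter>a. {u :: 'd state. 0 < energy_fun a u})"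
    by (auto simp: A_set_iff)
  ultimately show ?thesis
    by (auto intro!: convex_Int convex_INT convex_positive_linear rho_linear Er_linear energy_fun_linear)
qed

section \<open>Functions differentiable off a finite set\<close>

lemma mono_off_finite:
  fixes h h' :: "real \<Rightarrow> real"
  assumes "a \<le> c" "finite S" "continuous_on {a..c} h"
    and deriv: "\<And>x. x \<in> {a<..<c} - S \<Longrightarrow> (h has_vector_derivative h' x) (at x)"
    and nonneg: "\<And>x. x \<in> {a<..<c} - S \<Longrightarrow> 0 \<le> h' x"
  shows "h a \<le> h c"
proof -
  let ?d = "\<lambda>x. if x \<in> {a<..<c} - S then h' x else 0"
  have "(?d has_integral (h c - h a)) {a..c}"
    by (rule fundamental_theorem_of_calculus_interior_strong[OF assms(2,1) _ assms(3)])
       (use deriv in auto)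
  then have "0 \<le> h c - h a"
    by (rule has_integral_nonneg) (use nonneg in auto)
  then show ?thesis by simp
qed

lemma const_off_finite:
  fixes h :: "real \<Rightarrow> real"
  assumes "a \<le> c" "finite S" "continuous_on {a..c} h"
    and deriv: "\<And>x. x \<in> {a<..<c} - S \<Longrightarrow> (h has_vector_derivative 0) (at x)"
  shows "h a = h c"
proof -
  have "((\<lambda>_. 0) has_integral (h c - h a)) {a..c}"
    by (rule fundamental_theorem_of_calculus_interior_strong[OF assms(2,1) _ assms(3)])
       (use deriv in auto)
  then have "h c - h a = 0"
    using has_integral_0_eq by blast
  then show ?thesis by simp
qed

lemma strict_mono_off_finite:
  fixes h h' :: "real \<Rightarrow> real"
  assumes "finite S" and cont: "continuous_on {a..c} h"
    and deriv: "\<And>x. x \<in> {a<..<c} - S \<Longrightarrow> (h has_vector_derivative h' x) (at x)"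
    and nonneg: "\<And>x. x \<in> {a<..<c} - S \<Longrightarrow> 0 \<le> h' x"
    and t: "t \<in> {a<..<c} - S" "0 < h' t"
  shows "h a < h c"
proof -
  have le: "h x \<le> h y" if "a \<le> x" "x \<le> y" "y \<le> c" for x y
  proof (rule mono_off_finite[OF that(2) assms(1), where h' = h'])
    show "continuous_on {x..y} h" using cont that continuous_on_subset by fastforce
  qed (use that deriv nonneg in auto)
  have "DERIV h t :> h' t"
    using deriv[OF t(1)] by (simp add: has_real_derivative_iff_has_vector_derivative)
  from DERIV_pos_inc_right[OF this t(2)]
  obtain d where d: "0 < d" "\<And>k. 0 < k \<Longrightarrow> k < d \<Longrightarrow> h t < h (t + k)"
    by blast
  define k where "k = min (d / 2) (c - t)"
  have "0 < k" "k < d" "t + k \<le> c"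
    using t d(1) by (auto simp: k_def)
  then have "h t < h (t + k)" "h (t + k) \<le> h c" "h a \<le> h t"
    using d(2) le t(1) by auto
  then show ?thesis by linarith
qed

section \<open>Self-similar profiles of the extended system\<close>

lemma flux_with_eq:
  "flux_with P u c = (rho u * (vel u \<bullet> c), (mom u \<bullet> c) *\<^sub>R vel u + P *\<^sub>R c,
    (Em u + P) * (vel u \<bullet> c), Er u * (vel u \<bullet> c))"
proof -
  have "(\<chi> k l. vel u $ k * mom u $ l) *v c = (mom u \<bullet> c) *\<^sub>R vel u"
    by (simp add: vec_eq_iff matrix_vector_mult_def inner_vec_def sum_distrib_left sum_distrib_right mult_ac)
  moreover have "mat P *v c = P *\<^sub>R c"
    by (simp add: vec_eq_iff matrix_vector_mult_def mat_def if_distrib if_distribR sum.delta cong: if_cong)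
  ultimately show ?thesis
    by (simp add: flux_with_def matrix_vector_mult_add_rdistrib)
qed

lemma ext_flux_0 [simp]: "ext_flux b 0 n = 0"
  by (simp add: ext_flux_def flux_with_eq phat_def vel_def eint_def prod_eq_iff)

text \<open>The properties of a self-similar solution that are used below.  The state \<open>w x\<close> is the solution
  at the similarity variable \<open>x\<close>, the finite set \<open>S\<close> contains the breakpoints, and \<open>G\<close> is the flux
  through the ray of slope \<open>x\<close>.\<close>

locale self_similar_profile =
  fixes b :: real and n :: "real^'d::finite" and wL wR :: "'d ext" and w :: "real \<Rightarrow> 'd ext"
    and S :: "real set" and G :: "real \<Rightarrow> 'd ext"
  assumes hyp: "\<And>x. w x = 0 \<or> hyperbolic b (w x)"
    and hypL: "hyperbolic b wL" and hypR: "hyperbolic b wR"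
    and left: "\<forall>\<^sub>F x in at_bot. w x = wL"
    and right: "\<forall>\<^sub>F x in at_top. w x = wR"
    and fin: "finite S"
    and G_eq: "\<And>x. G x = ext_flux b (w x) n - x *\<^sub>R w x"
    and G_cont: "continuous_on UNIV G"
    and G_deriv: "\<And>x. x \<notin> S \<Longrightarrow> (G has_vector_derivative - w x) (at x)"
begin

lemma linear_G_cont:
  assumes "linear (\<phi> :: 'd ext \<Rightarrow> real)"
  shows "continuous_on A (\<lambda>x. \<phi> (G x))"
proof -
  have "continuous_on UNIV (\<lambda>x. \<phi> (G x))"
    using linear_continuous_on_compose[OF G_cont assms] .
  then show ?thesis by (rule continuous_on_subset) simp
qed

lemma linear_G_deriv:
  assumes "linear (\<phi> :: 'd ext \<Rightarrow> real)" "x \<notin> S"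
  shows "((\<lambda>x. \<phi> (G x)) has_vector_derivative - \<phi> (w x)) (at x)"
proof -
  have "bounded_linear \<phi>" using assms(1) by (simp add: linear_conv_bounded_linear)
  from bounded_linear.has_vector_derivative[OF this G_deriv[OF assms(2)]]
  show ?thesis by (simp add: linear_neg[OF assms(1)])
qed

text \<open>The mass flux through the ray of slope \<open>x\<close>.\<close>

definition q :: "real \<Rightarrow> real" where "q x = rho (fst (G x))"

lemma rho_fst_linear: "linear (\<lambda>z :: 'd ext. rho (fst z))"
  by (intro linearI) (auto simp: rho_def)

lemma q_eq: "q x = rho (fst (w x)) * (vel (fst (w x)) \<bullet> n - x)"
  by (simp add: q_def G_eq ext_flux_def flux_with_eq rho_def algebra_simps)

lemma rho_nonneg: "0 \<le> rho (fst (w x))"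
  using hyp[of x] by (auto simp: hyperbolic_def)

lemma q_antimono:
  assumes "x \<le> y" shows "q y \<le> q x"
proof -
  have "- q x \<le> - q y"
  proof (rule mono_off_finite[OF assms fin, where h' = "\<lambda>x. rho (fst (w x))"])
    show "continuous_on {x..y} (\<lambda>x. - q x)"
      unfolding q_def by (intro continuous_on_minus linear_G_cont rho_fst_linear)
    show "((\<lambda>x. - q x) has_vector_derivative rho (fst (w z))) (at z)" if "z \<in> {x<..<y} - S" for z
      using has_vector_derivative_minus[OF linear_G_deriv[OF rho_fst_linear, of z]] that
      by (simp add: q_def)
  qed (rule rho_nonneg)
  then show ?thesis by simp
qed

text \<open>An advected quantity \<open>X\<close> satisfies \<open>X (G x) = X (w x) (v - x)\<close> with \<open>v\<close> the normal velocity,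
  and \<open>(X (G x))' = - X (w x)\<close>; the same holds for the density.  By the quotient rule
  \<open>X (G x) / q x\<close>, which equals \<open>X (w x) / \<rho>\<close>, has derivative zero.\<close>

lemma advected_ratio_interval:
  fixes X :: "'d ext \<Rightarrow> real"
  assumes lin: "linear X" and X: "\<And>z. X (ext_flux b z n) = X z * (vel (fst z) \<bullet> n)"
    and "x \<le> y" and q: "\<And>z. z \<in> {x..y} \<Longrightarrow> q z \<noteq> 0"
  shows "X (w x) * rho (fst (w y)) = X (w y) * rho (fst (w x))"
proof -
  have XG: "X (G z) = X (w z) * (vel (fst (w z)) \<bullet> n - z)" for z
    by (simp add: G_eq linear_diff[OF lin] linear_scale[OF lin] X algebra_simps)
  have ratio: "X (G z) / q z = X (w z) / rho (fst (w z))" if "z \<in> {x..y}" for z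
    using q[OF that] by (simp add: XG q_eq)
  have "X (G x) / q x = X (G y) / q y"
  proof (rule const_off_finite[OF \<open>x \<le> y\<close> fin])
    show "continuous_on {x..y} (\<lambda>z. X (G z) / q z)"
      using q unfolding q_def by (intro continuous_on_divide linear_G_cont lin rho_fst_linear) auto
    show "((\<lambda>z. X (G z) / q z) has_vector_derivative 0) (at z)" if z: "z \<in> {x<..<y} - S" for z
    proof -
      have "((\<lambda>z. X (G z)) has_field_derivative - X (w z)) (at z)"
           "(q has_field_derivative - rho (fst (w z))) (at z)"
        using linear_G_deriv[OF lin, of z] linear_G_deriv[OF rho_fst_linear, of z] z
        by (simp_all add: has_real_derivative_iff_has_vector_derivative q_def[abs_def])
      from DERIV_divide[OF this] q[of z] z
      have "((\<lambda>z. X (G z) / q z) has_field_derivative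
          (- X (w z) * q z - X (G z) * - rho (fst (w z))) / (q z * q z)) (at z)"
        by simp
      moreover have "- X (w z) * q z - X (G z) * - rho (fst (w z)) = 0"
        by (simp add: XG q_eq)
      ultimately show ?thesis
        by (simp add: has_real_derivative_iff_has_vector_derivative)
    qed
  qed
  moreover have "rho (fst (w x)) \<noteq> 0" "rho (fst (w y)) \<noteq> 0"
    using q[of x] q[of y] \<open>x \<le> y\<close> by (auto simp: q_eq)
  ultimately show ?thesis
    using ratio[of x] ratio[of y] \<open>x \<le> y\<close> by (simp add: frac_eq_eq)
qed

text \<open>As \<open>q\<close> is nonincreasing, a positive value of \<open>q\<close> at \<open>x\<close> connects \<open>x\<close> with the left datum,
  and a negative value connects \<open>x\<close> with the right datum.\<close>

lemma advected_ratio: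
  fixes X :: "'d ext \<Rightarrow> real"
  assumes lin: "linear X" and X: "\<And>z. X (ext_flux b z n) = X z * (vel (fst z) \<bullet> n)"
    and "q x \<noteq> 0"
  obtains "X (w x) * rho (fst wL) = X wL * rho (fst (w x))"
  | "X (w x) * rho (fst wR) = X wR * rho (fst (w x))"
proof (cases "0 < q x")
  case True
  have "\<forall>\<^sub>F y in at_bot. w y = wL \<and> y \<le> x"
    using left eventually_le_at_bot by (rule eventually_conj)
  then obtain y where y: "w y = wL" "y \<le> x"
    using eventually_happens'[OF trivial_limit_at_bot_linorder] by blast
  have "q z \<noteq> 0" if "z \<in> {y..x}" for z
    using q_antimono[of z x] True that by simp
  from advected_ratio_interval[OF lin X y(2) this] y(1) that(1) show ?thesis by simp
next
  case False
  with assms(3) have neg: "q x < 0" by simp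
  have "\<forall>\<^sub>F y in at_top. w y = wR \<and> x \<le> y"
    using right eventually_ge_at_top by (rule eventually_conj)
  then obtain y where y: "w y = wR" "x \<le> y"
    using eventually_happens'[OF trivial_limit_at_top_linorder] by blast
  have "q z \<noteq> 0" if "z \<in> {x..y}" for z
    using q_antimono[of x z] neg that by simp
  from advected_ratio_interval[OF lin X y(2) this] y(1) that(2) show ?thesis by simp
qed

lemma advected_bound:
  fixes X :: "'d ext \<Rightarrow> real"
  assumes lin: "linear X" and X: "\<And>z. X (ext_flux b z n) = X z * (vel (fst z) \<bullet> n)"
    and "q x \<noteq> 0" and L: "0 < X wL" and R: "0 < X wR"
  shows "0 < X (w x)"
proof -
  have w: "0 < rho (fst (w x))" using assms(3) rho_nonneg[of x] by (auto simp: q_eq less_le)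
  have LR: "0 < rho (fst wL)" "0 < rho (fst wR)" using hypL hypR by (auto simp: hyperbolic_def)
  show ?thesis
  proof (rule advected_ratio[OF lin X assms(3)])
    assume "X (w x) * rho (fst wL) = X wL * rho (fst (w x))"
    moreover have "0 < X wL * rho (fst (w x))" using w L by simp
    ultimately show ?thesis using LR by (metis zero_less_mult_pos2)
  next
    assume "X (w x) * rho (fst wR) = X wR * rho (fst (w x))"
    moreover have "0 < X wR * rho (fst (w x))" using w R by simp
    ultimately show ?thesis using LR by (metis zero_less_mult_pos2)
  qed
qed

text \<open>The density component of \<open>G' = - w\<close> is \<open>q' = - \<rho>\<close>, so a nonincreasing \<open>q\<close> cannot stay zero to the
  right of a differentiability point at which it vanishes and \<open>\<rho> > 0\<close>.  The exceptional set has
  thus at most one point.\<close>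

lemma vacuum_where_q_zero:
  "finite {x. x \<notin> S \<and> q x = 0 \<and> w x \<noteq> 0}" (is "finite ?T")
proof -
  have less: False if "x \<in> ?T" "y \<in> ?T" "x < y" for x y
  proof -
    have "DERIV q x :> - rho (fst (w x))"
      using linear_G_deriv[OF rho_fst_linear, of x] that(1)
      by (simp add: has_real_derivative_iff_has_vector_derivative q_def[abs_def])
    moreover have "- rho (fst (w x)) < 0"
      using hyp[of x] that(1) by (auto simp: hyperbolic_def)
    ultimately obtain d where d: "0 < d" "\<And>k. 0 < k \<Longrightarrow> k < d \<Longrightarrow> q (x + k) < q x"
      using DERIV_neg_dec_right by blast
    define k where "k = min (d / 2) (y - x)"
    have "0 < k" "k < d" "x + k \<le> y" using d(1) that(3) by (auto simp: k_def)
    with d(2) q_antimono[of "x + k" y] that show False by force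
  qed
  have "\<exists>x. ?T \<subseteq> {x}"
  proof (cases "?T = {}")
    case False
    then obtain x where "x \<in> ?T" by blast
    have "y = x" if "y \<in> ?T" for y
      using less[OF that \<open>x \<in> ?T\<close>] less[OF \<open>x \<in> ?T\<close> that] linorder_less_linear[of x y] by blast
    then show ?thesis by blast
  next
    case True
    then show ?thesis by (metis empty_subsetI)
  qed
  then show ?thesis by (meson finite.emptyI finite.insertI finite_subset)
qed

lemma admissible_off_finite:
  assumes "0 < Er (fst wL)" "0 < Er (fst wR)"
    and "rho (fst wL) < snd wL" "rho (fst wR) < snd wR"
  obtains T where "finite T" "S \<subseteq> T" "\<And>x. x \<notin> T \<Longrightarrow> w x = 0 \<or> fst (w x) \<in> A_set b"
proof
  let ?T = "S \<union> {x. x \<notin> S \<and> q x = 0 \<and> w x \<noteq> 0}"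
  show "finite ?T" using fin vacuum_where_q_zero by simp
  show "S \<subseteq> ?T" by simp
  fix x assume x: "x \<notin> ?T"
  show "w x = 0 \<or> fst (w x) \<in> A_set b"
  proof (cases "w x = 0")
    case False
    with x have q: "q x \<noteq> 0" by blast
    have h: "0 < rho (fst (w x))" "0 < 1 - b * rho (fst (w x))" "0 < sound2 b (w x)"
      using hyp[of x] False by (auto simp: hyperbolic_def)
    have Er: "0 < Er (fst (w x))"
      by (rule advected_bound[OF _ _ q])
         (use assms in \<open>auto intro!: linearI simp: Er_def ext_flux_def flux_with_eq algebra_simps\<close>)
    \<comment> \<open>Both \<open>\<Gamma>\<close> and \<open>\<rho>\<close> are advected, hence so is their difference.\<close>
    have "0 < (\<lambda>z. snd z - rho (fst z)) (w x)"
      by (rule advected_bound[OF _ _ q])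
         (use assms in \<open>auto intro!: linearI simp: rho_def ext_flux_def flux_with_eq algebra_simps\<close>)
    then have \<Gamma>: "rho (fst (w x)) < snd (w x)" by simp
    have "0 < snd (w x) / rho (fst (w x))" "0 < rho (fst (w x)) * (1 - b * rho (fst (w x)))"
      using \<Gamma> h by auto
    with h(3) have "0 < phat b (w x)"
      unfolding sound2_def by (metis zero_less_divide_iff zero_less_mult_pos less_asym)
    moreover have "0 < (snd (w x) - rho (fst (w x))) / (1 - b * rho (fst (w x)))"
      using \<Gamma> h by auto
    ultimately have "0 < eint (fst (w x))"
      unfolding phat_def using zero_less_mult_pos by blast
    with h Er show ?thesis by (auto simp: A_set_def B_set_def)
  qed simp
qed

end

section \<open>Riemann averages\<close>

text \<open>The ordinary differential equation gives \<open>G' = \<xi> w' - (w + \<xi> w') = - w\<close> off the breakpoints,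
  and the Rankine-Hugoniot relation identifies the one-sided limits of \<open>G\<close> at a breakpoint.\<close>

lemma lax_solution_profile:
  assumes sol: "lax_riemann_solution b n wL wR w" and "hyperbolic b wL" "hyperbolic b wR"
  obtains S where "self_similar_profile b n wL wR w S (\<lambda>x. ext_flux b (w x) n - x *\<^sub>R w x)"
proof -
  let ?f = "\<lambda>z. ext_flux b z n"
  let ?G = "\<lambda>x. ?f (w x) - x *\<^sub>R w x"
  \<comment> \<open>The jump relation at a breakpoint, without the entropy condition.\<close>
  define J where "J s wm \<longleftrightarrow> (w \<longlongrightarrow> wm) (at_left s) \<and> ((\<lambda>\<eta>. ?f (w \<eta>)) \<longlongrightarrow> ?f wm) (at_left s) \<and>
          (w \<longlongrightarrow> w s) (at_right s) \<and> ((\<lambda>\<eta>. ?f (w \<eta>)) \<longlongrightarrow> ?f (w s)) (at_right s) \<and>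
          ?f (w s) - ?f wm = s *\<^sub>R (w s - wm)" for s wm
  have range: "\<forall>x. w x = 0 \<or> hyperbolic b (w x)" "\<forall>\<^sub>F x in at_bot. w x = wL"
    "\<forall>\<^sub>F x in at_top. w x = wR"
    using sol unfolding lax_riemann_solution_def Let_def by blast+
  have "\<exists>S. finite S \<and> w C1_differentiable_on (- S) \<and>
      (\<forall>x\<in>- S. ((\<lambda>\<eta>. ?f (w \<eta>)) has_vector_derivative x *\<^sub>R vector_derivative w (at x)) (at x)) \<and>
      (\<forall>s\<in>S. \<exists>wm. J s wm)"
    using sol unfolding lax_riemann_solution_def Let_def J_def by meson
  then obtain S where S: "finite S" "w C1_differentiable_on (- S)"
    and ode: "\<And>x. x \<notin> S \<Longrightarrow> ((\<lambda>\<eta>. ?f (w \<eta>)) has_vector_derivative x *\<^sub>R vector_derivative w (at x)) (at x)"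
    and jump: "\<And>s. s \<in> S \<Longrightarrow> \<exists>wm. J s wm"
    by (metis ComplI)
  have deriv: "(?G has_vector_derivative - w x) (at x)" if "x \<notin> S" for x
  proof -
    have "(w has_vector_derivative vector_derivative w (at x)) (at x)"
      using S(2) that by (auto simp: C1_differentiable_on_eq vector_derivative_works)
    from has_vector_derivative_diff[OF ode[OF that]
        has_vector_derivative_scaleR[OF DERIV_ident this]]
    show ?thesis by simp
  qed
  have "isCont ?G x" for x
  proof (cases "x \<in> S")
    case True
    then obtain wm where
      l: "(w \<longlongrightarrow> wm) (at_left x)" "((\<lambda>\<eta>. ?f (w \<eta>)) \<longlongrightarrow> ?f wm) (at_left x)" and
      r: "(w \<longlongrightarrow> w x) (at_right x)" "((\<lambda>\<eta>. ?f (w \<eta>)) \<longlongrightarrow> ?f (w x)) (at_right x)" and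
      rh: "?f (w x) - ?f wm = x *\<^sub>R (w x - wm)"
      using jump unfolding J_def by blast
    have "(?G \<longlongrightarrow> ?f wm - x *\<^sub>R wm) (at_left x)"
      by (intro tendsto_intros l)
    moreover have "?f wm - x *\<^sub>R wm = ?G x"
      using rh by (simp add: algebra_simps)
    moreover have "(?G \<longlongrightarrow> ?G x) (at_right x)"
      by (intro tendsto_intros r)
    ultimately show ?thesis
      by (simp add: isCont_def filterlim_at_split)
  next
    case False
    then show ?thesis using deriv has_vector_derivative_continuous by blast
  qed
  then have "continuous_on UNIV ?G"
    by (simp add: continuous_on_eq_continuous_at)
  with range have "self_similar_profile b n wL wR w S ?G"
    using S(1) deriv assms(2,3) by unfold_locales blast+
  then show thesis using that by blast
qed

lemma constant_outside_wave_speeds: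
  fixes w :: "real \<Rightarrow> 'a"
  assumes "open I" "connected I" "wave_speeds w \<inter> I = {}" "x \<in> I" "y \<in> I"
  shows "w x = w y"
proof (rule connected_local_const[OF assms(2,4,5)], rule ballI)
  fix z assume z: "z \<in> I"
  with assms(3) have "\<forall>\<^sub>F \<eta> in nhds z. w \<eta> = w z" by (auto simp: wave_speeds_def)
  then have "\<forall>\<^sub>F \<eta> in at z within I. w \<eta> = w z"
    by (simp add: eventually_at_filter eventually_mono)
  then show "\<forall>\<^sub>F \<eta> in at z within I. w z = w \<eta>"
    by (rule eventually_mono) simp
qed

lemma phat_Theta:
  assumes "u \<in> B_set b"
  shows "phat b (Theta b p u) = p u"
  using assms by (simp add: phat_def Theta_def B_set_def)

lemma hyperbolic_Theta:
  assumes "u \<in> B_set b" "0 < p u"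
  shows "hyperbolic b (Theta b p u)" and "rho (fst (Theta b p u)) < snd (Theta b p u)"
proof -
  show *: "rho (fst (Theta b p u)) < snd (Theta b p u)"
    using assms by (simp add: Theta_def B_set_def)
  have "0 < rho u" "0 < 1 - b * rho u" using assms by (auto simp: B_set_def)
  moreover from this * have "0 < snd (Theta b p u)" by (simp add: Theta_def)
  ultimately show "hyperbolic b (Theta b p u)"
    using assms phat_Theta[OF assms(1), of p]
    by (simp add: hyperbolic_def sound2_def) (simp add: Theta_def)
qed

lemma ext_flux_Theta:
  assumes "u \<in> B_set b"
  shows "fst (ext_flux b (Theta b p u) n) = flux p u n"
  using phat_Theta[OF assms, of p] by (simp add: ext_flux_def flux_def) (simp add: Theta_def)

text \<open>The bar state for a unit vector \<open>n\<close> and a wave speed bound \<open>l\<close>; it is the average over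
  \<open>[- l, l]\<close> of the Riemann solution in direction \<open>n\<close>.\<close>

definition bar_state :: "(('d::finite) state \<Rightarrow> real) \<Rightarrow> real^'d \<Rightarrow> real \<Rightarrow> 'd state \<Rightarrow> 'd state \<Rightarrow> 'd state" where
  "bar_state p n l uL uR = (1/2) *\<^sub>R (uL + uR) - (1 / (2 * l)) *\<^sub>R (flux p uR n - flux p uL n)"

lemma bar_state_admissible:
  fixes uL uR :: "('d::finite) state"
  assumes n: "norm n = 1" and uL: "uL \<in> A_set b" and uR: "uR \<in> A_set b"
    and p: "0 < p uL" "0 < p uR" and l: "0 < l"
    and speed: "max_wave_speed_bound b n (Theta b p uL) (Theta b p uR) l"
  shows "bar_state p n l uL uR \<in> A_set b"
proof -
  let ?wL = "Theta b p uL" and ?wR = "Theta b p uR"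
  have B: "uL \<in> B_set b" "uR \<in> B_set b" using uL uR by (auto simp: A_set_def)
  from speed obtain w where sol: "lax_riemann_solution b n ?wL ?wR w"
    and ws: "\<And>x. x \<in> wave_speeds w \<Longrightarrow> \<bar>x\<bar> \<le> l"
    unfolding max_wave_speed_bound_def by blast
  define G where "G x = ext_flux b (w x) n - x *\<^sub>R w x" for x
  obtain S where "self_similar_profile b n ?wL ?wR w S G"
    using lax_solution_profile[OF sol] hyperbolic_Theta(1) B p unfolding G_def[abs_def] by blast
  then interpret self_similar_profile b n ?wL ?wR w S G .
  obtain T where T: "finite T" "S \<subseteq> T" "\<And>x. x \<notin> T \<Longrightarrow> w x = 0 \<or> fst (w x) \<in> A_set b"
    by (rule admissible_off_finite)
       (use uL uR B p in \<open>auto simp: hyperbolic_Theta(2)\<close>, auto simp: Theta_def A_set_def)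
  have wL: "w x = ?wL" if "x < - l" for x
  proof -
    have "\<forall>\<^sub>F y in at_bot. w y = ?wL \<and> y \<le> x"
      using left eventually_le_at_bot by (rule eventually_conj)
    then obtain y where "w y = ?wL" "y \<le> x"
      using eventually_happens'[OF trivial_limit_at_bot_linorder] by blast
    moreover have "w x = w y"
      by (rule constant_outside_wave_speeds[of "{..<-l}"]) (use ws that \<open>y \<le> x\<close> in force)+
    ultimately show ?thesis by simp
  qed
  have wR: "w x = ?wR" if "l < x" for x
  proof -
    have "\<forall>\<^sub>F y in at_top. w y = ?wR \<and> x \<le> y"
      using right eventually_ge_at_top by (rule eventually_conj)
    then obtain y where "w y = ?wR" "x \<le> y"
      using eventually_happens'[OF trivial_limit_at_top_linorder] by blast
    moreover have "w x = w y"
      by (rule constant_outside_wave_speeds[of "{l<..}"]) (use ws that \<open>x \<le> y\<close> in force)+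
    ultimately show ?thesis by simp
  qed
  have Gc: "(G \<longlongrightarrow> G x) (at x within A)" for x A
    using G_cont by (meson UNIV_I continuous_on_def tendsto_within_subset subset_UNIV)
  have GL: "G (- l) = ext_flux b ?wL n + l *\<^sub>R ?wL"
  proof (rule tendsto_unique[OF trivial_limit_at_left_real Gc])
    have "((\<lambda>x. ext_flux b ?wL n - x *\<^sub>R ?wL) \<longlongrightarrow> ext_flux b ?wL n - (- l) *\<^sub>R ?wL) (at_left (- l))"
      by (intro tendsto_intros)
    then show "(G \<longlongrightarrow> ext_flux b ?wL n + l *\<^sub>R ?wL) (at_left (- l))"
      by (subst tendsto_cong[where g = "\<lambda>x. ext_flux b ?wL n - x *\<^sub>R ?wL"])
         (auto simp: eventually_at_filter G_def wL)
  qed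
  have GR: "G l = ext_flux b ?wR n - l *\<^sub>R ?wR"
  proof (rule tendsto_unique[OF trivial_limit_at_right_real Gc])
    have "((\<lambda>x. ext_flux b ?wR n - x *\<^sub>R ?wR) \<longlongrightarrow> ext_flux b ?wR n - l *\<^sub>R ?wR) (at_right l)"
      by (intro tendsto_intros)
    then show "(G \<longlongrightarrow> ext_flux b ?wR n - l *\<^sub>R ?wR) (at_right l)"
      by (subst tendsto_cong[where g = "\<lambda>x. ext_flux b ?wR n - x *\<^sub>R ?wR"])
         (auto simp: eventually_at_filter G_def wR)
  qed
  have avg: "fst (G (- l)) - fst (G l) = (2 * l) *\<^sub>R bar_state p n l uL uR"
  proof -
    have "fst (G (- l)) - fst (G l) = flux p uL n + l *\<^sub>R uL - (flux p uR n - l *\<^sub>R uR)"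
      by (simp add: GL GR ext_flux_Theta B) (simp add: Theta_def)
    also have "\<dots> = (2 * l) *\<^sub>R bar_state p n l uL uR"
      using l by (simp add: bar_state_def scaleR_diff_right algebra_simps)
    finally show ?thesis .
  qed
  \<comment> \<open>Vacuum throughout \<open>(- l, l)\<close> would make \<open>G\<close> vanish at \<open>- l\<close>.  By the mass component the left
    state then moves with normal velocity \<open>- l\<close>, and the momentum component leaves zero pressure.\<close>
  obtain x0 where x0: "x0 \<in> {-l<..<l} - T" "w x0 \<noteq> 0"
  proof (rule ccontr)
    assume "\<not> thesis"
    with that have vac: "w x = 0" if "x \<in> {-l<..<l} - T" for x using that by blast
    have "\<forall>\<^sub>F x in at_right (- l). x < l"
      using l by (auto simp: eventually_at_right[of "- l" l] intro!: exI[of _ l])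
    moreover have "\<forall>\<^sub>F x in at_right (- l). x \<notin> T"
      using islimpt_finite[OF T(1), of "- l"] at_le[of "{-l<..}" UNIV "- l"]
      by (auto simp: islimpt_iff_eventually intro: filter_leD)
    moreover have "\<forall>\<^sub>F x in at_right (- l). -l < x"
      by (simp add: eventually_at_filter)
    ultimately have "\<forall>\<^sub>F x in at_right (- l). G x = 0"
      by eventually_elim (simp add: G_def vac)
    then have "(G \<longlongrightarrow> 0) (at_right (- l))" by (rule tendsto_eventually)
    then have "G (- l) = 0"
      using tendsto_unique[OF trivial_limit_at_right_real Gc] by blast
    then have "fst (ext_flux b ?wL n + l *\<^sub>R ?wL) = 0" by (simp add: GL[symmetric])
    then have "flux p uL n + l *\<^sub>R uL = 0"
      by (simp add: ext_flux_Theta[OF B(1)]) (simp add: Theta_def)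
    then have 1: "rho uL * (vel uL \<bullet> n) + l * rho uL = 0"
      and 2: "(mom uL \<bullet> n) *\<^sub>R vel uL + p uL *\<^sub>R n + l *\<^sub>R mom uL = 0"
      by (simp_all add: flux_def flux_with_eq prod_eq_iff rho_def mom_def)
    have r: "0 < rho uL" using B(1) by (simp add: B_set_def)
    have v: "vel uL \<bullet> n = - l"
    proof -
      have "rho uL * (vel uL \<bullet> n + l) = 0" using 1 by (simp add: algebra_simps)
      with r show ?thesis by simp
    qed
    have *: "((mom uL \<bullet> n) *\<^sub>R vel uL + p uL *\<^sub>R n + l *\<^sub>R mom uL) \<bullet> n = 0"
      unfolding 2 by simp
    have "p uL = 0"
    proof -
      have "n \<bullet> n = 1" using n by (simp add: norm_eq_1)
      then show ?thesis
        using r * by (simp add: inner_add_left inner_diff_left mom_eq_vel v)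
    qed
    with p(1) show False by simp
  qed
  have x0A: "fst (w x0) \<in> A_set b" using T(3)[of x0] x0 by blast
  have pos: "0 < \<phi> (bar_state p n l uL uR)"
    if lin: "linear \<phi>" and \<phi>: "\<And>z. z \<in> A_set b \<Longrightarrow> 0 < \<phi> z" for \<phi> :: "'d state \<Rightarrow> real"
  proof -
    have lin': "linear (\<lambda>z :: 'd ext. \<phi> (fst z))"
      using linear_compose[OF linear_fst lin] by (simp add: o_def)
    have "- \<phi> (fst (G (- l))) < - \<phi> (fst (G l))"
    proof (rule strict_mono_off_finite[OF T(1), where h = "\<lambda>x. - \<phi> (fst (G x))" and h' = "\<lambda>x. \<phi> (fst (w x))" and t = x0])
      show "continuous_on {- l..l} (\<lambda>x. - \<phi> (fst (G x)))"
        by (intro continuous_on_minus linear_G_cont[OF lin'])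
      show "((\<lambda>x. - \<phi> (fst (G x))) has_vector_derivative \<phi> (fst (w x))) (at x)"
        if "x \<in> {- l<..<l} - T" for x
        using has_vector_derivative_minus[OF linear_G_deriv[OF lin', of x]] that T(2) by auto
      show "0 \<le> \<phi> (fst (w x))" if "x \<in> {- l<..<l} - T" for x
        using T(3)[of x] that \<phi>[of "fst (w x)"] linear_0[OF lin] by auto
    qed (use x0 x0A \<phi> in auto)
    then have "0 < \<phi> (fst (G (- l)) - fst (G l))"
      by (simp add: linear_diff[OF lin])
    then show ?thesis
      using l by (simp add: avg linear_scale[OF lin] zero_less_mult_iff)
  qed
  \<comment> \<open>The constant \<open>1\<close> in this affine condition is the derivative of the added term \<open>x\<close>.\<close>
  have "b * rho (bar_state p n l uL uR) < 1"
  proof -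
    have "b * rho (fst (G (- l))) + (- l) < b * rho (fst (G l)) + l"
    proof (rule strict_mono_off_finite[OF T(1), where h = "\<lambda>x. b * rho (fst (G x)) + x" and h' = "\<lambda>x. b * (- rho (fst (w x))) + 1" and t = x0])
      show "continuous_on {- l..l} (\<lambda>x. b * rho (fst (G x)) + x)"
        by (intro continuous_intros linear_G_cont rho_fst_linear)
      show "((\<lambda>x. b * rho (fst (G x)) + x) has_vector_derivative b * (- rho (fst (w x))) + 1) (at x)"
        if "x \<in> {- l<..<l} - T" for x
      proof -
        have "((\<lambda>x. rho (fst (G x))) has_field_derivative - rho (fst (w x))) (at x)"
          using linear_G_deriv[OF rho_fst_linear, of x] that T(2)
          by (auto simp: has_real_derivative_iff_has_vector_derivative)
        from DERIV_add[OF DERIV_cmult[OF this] DERIV_ident]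
        show ?thesis by (simp add: has_real_derivative_iff_has_vector_derivative)
      qed
      show "0 \<le> b * (- rho (fst (w x))) + 1" if "x \<in> {- l<..<l} - T" for x
        using hyp[of x] by (auto simp: hyperbolic_def)
    qed (use x0 x0A in \<open>auto simp: A_set_def B_set_def\<close>)
    then have "b * rho (fst (G (- l)) - fst (G l)) < 2 * l"
      by (simp add: linear_diff[OF rho_linear] algebra_simps)
    then have "2 * l * (b * rho (bar_state p n l uL uR)) < 2 * l * 1"
      by (simp add: avg linear_scale[OF rho_linear] mult_ac)
    then show ?thesis using l by (simp only: mult_less_cancel_left_pos)
  qed
  moreover have "0 < rho (bar_state p n l uL uR)" "0 < Er (bar_state p n l uL uR)"
    "\<And>a. 0 < energy_fun a (bar_state p n l uL uR)"
    using pos[OF rho_linear] pos[OF Er_linear] pos[OF energy_fun_linear] by (simp_all add: A_set_iff)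
  ultimately show ?thesis by (simp add: A_set_iff)
qed

section \<open>The update\<close>

lemma flux_linear: "linear (flux p (u :: ('d::finite) state))"
  by (intro linearI)
     (auto simp: flux_def flux_with_eq inner_add_right algebra_simps)

lemma max_wave_speed_bound_mono:
  "max_wave_speed_bound b n wL wR l \<Longrightarrow> l \<le> l' \<Longrightarrow> max_wave_speed_bound b n wL wR l'"
  unfolding max_wave_speed_bound_def by (meson order_trans)

lemma d1_sym: "d1 lam c u i j = d1 lam c u j i"
  by (simp add: d1_def max.commute)

lemma sum_stencil_swap:
  fixes F :: "'v::finite \<Rightarrow> 'v \<Rightarrow> 'a::comm_monoid_add"
  assumes "\<And>i j. j \<in> st i \<longleftrightarrow> i \<in> st j"
  shows "(\<Sum>i\<in>UNIV. \<Sum>j\<in>st i. F i j) = (\<Sum>i\<in>UNIV. \<Sum>j\<in>st i. F j i)"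
proof -
  have st: "st i = {j. j \<in> st i}" for i by simp
  have st': "{j\<in>UNIV. i \<in> st j} = st i" for i using assms by auto
  have "(\<Sum>i\<in>UNIV. \<Sum>j\<in>st i. F i j) = (\<Sum>i\<in>UNIV. \<Sum>j\<in>{j\<in>UNIV. j \<in> st i}. F i j)" by simp
  also have "\<dots> = (\<Sum>j\<in>UNIV. \<Sum>i\<in>{i\<in>UNIV. j \<in> st i}. F i j)"
    by (rule sum.swap_restrict) simp_all
  finally show ?thesis by (simp only: st')
qed

lemma sum_stencil_skew:
  fixes F :: "'v::finite \<Rightarrow> 'v \<Rightarrow> 'a::real_vector"
  assumes "\<And>i j. j \<in> st i \<longleftrightarrow> i \<in> st j" and "\<And>i j. F i j = - F j i"
  shows "(\<Sum>i\<in>UNIV. \<Sum>j\<in>st i. F i j) = 0"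
proof -
  have "(\<Sum>i\<in>UNIV. \<Sum>j\<in>st i. F i j) = (\<Sum>i\<in>UNIV. \<Sum>j\<in>st i. F j i)"
    using assms(1) by (rule sum_stencil_swap)
  also have "\<dots> = - (\<Sum>i\<in>UNIV. \<Sum>j\<in>st i. F i j)"
    by (subst assms(2)) (simp add: sum_negf)
  finally have "(2::real) *\<^sub>R (\<Sum>i\<in>UNIV. \<Sum>j\<in>st i. F i j) = 0"
    by (simp only: scaleR_2) (simp only: eq_neg_iff_add_eq_0)
  then show ?thesis by simp
qed

text \<open>The update of a single node with stencil \<open>N\<close>.  Since \<open>c i\<close> sums to zero over \<open>N\<close>, the sum
  of fluxes in the update may be replaced with their difference.\<close>

lemma update_admissible:
  fixes u :: "'v \<Rightarrow> ('d::finite) state" and u1 :: "'d state"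
  assumes fin: "finite N" and i: "i \<in> N" and m: "0 < m" and tau: "0 < \<tau>"
    and c_sum: "(\<Sum>j\<in>N. c i j) = 0"
    and p_pos: "\<And>z. z \<in> B_set b \<Longrightarrow> 0 < p z"
    and lam: "\<And>n uL uR. norm n = 1 \<Longrightarrow> uL \<in> B_set b \<Longrightarrow> uR \<in> B_set b \<Longrightarrow>
      0 < lam n uL uR \<and> max_wave_speed_bound b n (Theta b p uL) (Theta b p uR) (lam n uL uR)"
    and upd: "m *\<^sub>R u1 = m *\<^sub>R u i + \<tau> *\<^sub>R (\<Sum>j\<in>N.
      - (flux p (u j) (c i j) + flux p (u i) (c i j)) + d1 lam c u i j *\<^sub>R (u j - u i))"
    and adm: "\<And>j. u j \<in> A_set b"
    and CFL: "\<tau> * (2 / m * (\<Sum>j\<in>N - {i}. d1 lam c u i j)) \<le> 1"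
  shows "u1 \<in> A_set b"
proof -
  let ?d = "\<lambda>j. d1 lam c u i j"
  have B: "u j \<in> B_set b" for j using adm by (auto simp: A_set_def)
  \<comment> \<open>The bar state for \<open>j\<close> is taken with \<open>l = d / norm (c i j)\<close>, which is at least
    the given wave speed bound.
    If \<open>c i j\<close> vanishes, \<open>d\<close> may still be positive (through \<open>c j i\<close>), and the mean value of the two
    states serves instead.\<close>
  have "\<exists>z\<in>A_set b. 0 \<le> ?d j \<and>
      - (flux p (u j) (c i j) - flux p (u i) (c i j)) + ?d j *\<^sub>R (u j - u i) = (2 * ?d j) *\<^sub>R (z - u i)" for j
  proof (cases "c i j = 0")
    case True
    have "(1/2) *\<^sub>R u i + (1/2) *\<^sub>R u j \<in> A_set b"
      by (rule convexD[OF convex_A_set adm adm]) auto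
    moreover have "(2 * ?d j) *\<^sub>R (((1/2) *\<^sub>R u i + (1/2) *\<^sub>R u j) - u i) = ?d j *\<^sub>R (u j - u i)"
    proof -
      have "((1/2) *\<^sub>R u i + (1/2) *\<^sub>R u j) - u i = (1/2) *\<^sub>R (u j - u i)"
        using scaleR_half_double[of "u i"] by (simp add: algebra_simps scaleR_add_left[symmetric])
      then show ?thesis by simp
    qed
    moreover have "0 \<le> ?d j" using True by (simp add: d1_def)
    ultimately show ?thesis
      using True by (intro bexI[of _ "(1/2) *\<^sub>R u i + (1/2) *\<^sub>R u j"]) (auto simp: linear_0[OF flux_linear])
  next
    case False
    define n where "n = c i j /\<^sub>R norm (c i j)"
    define l where "l = ?d j / norm (c i j)"
    have c0: "0 < norm (c i j)" and n1: "norm n = 1" using False by (auto simp: n_def)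
    have L: "0 < lam n (u i) (u j)"
      "max_wave_speed_bound b n (Theta b p (u i)) (Theta b p (u j)) (lam n (u i) (u j))"
      using lam[OF n1 B B] by auto
    have "lam n (u i) (u j) * norm (c i j) \<le> ?d j"
      by (simp add: d1_def n_def)
    then have le: "lam n (u i) (u j) \<le> l"
      using c0 by (simp add: l_def field_simps)
    then have l: "0 < l" using L(1) by linarith
    then have d: "0 < ?d j" using c0 by (simp add: l_def zero_less_divide_iff)
    have dl: "?d j = l * norm (c i j)" using c0 by (simp add: l_def)
    have "bar_state p n l (u i) (u j) \<in> A_set b"
      by (rule bar_state_admissible[OF n1 adm adm p_pos[OF B] p_pos[OF B] l
            max_wave_speed_bound_mono[OF L(2) le]])
    moreover have "- (flux p (u j) (c i j) - flux p (u i) (c i j)) + ?d j *\<^sub>R (u j - u i) =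
        (2 * ?d j) *\<^sub>R (bar_state p n l (u i) (u j) - u i)"
    proof -
      have "c i j = norm (c i j) *\<^sub>R n" using c0 by (simp add: n_def)
      then have f: "flux p z (c i j) = norm (c i j) *\<^sub>R flux p z n" for z
        using linear_scale[OF flux_linear, of p z] by metis
      have h: "(2 * ?d j) *\<^sub>R u i = ?d j *\<^sub>R u i + ?d j *\<^sub>R u i" by (simp flip: scaleR_add_left)
      show ?thesis
        unfolding f bar_state_def scaleR_diff_right h using l c0
        by (simp add: dl scaleR_add_right algebra_simps)
    qed
    ultimately show ?thesis using d by (intro bexI[of _ "bar_state p n l (u i) (u j)"]) auto
  qed
  then obtain z where z: "\<And>j. z j \<in> A_set b" "\<And>j. 0 \<le> ?d j"
    "\<And>j. - (flux p (u j) (c i j) - flux p (u i) (c i j)) + ?d j *\<^sub>R (u j - u i) = (2 * ?d j) *\<^sub>R (z j - u i)"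
    by metis
  \<comment> \<open>The weights \<open>g\<close> and states \<open>y\<close> of the convex combination; the index \<open>i\<close> stands for \<open>u i\<close> itself.\<close>
  define a where "a j = \<tau> * (2 * ?d j) / m" for j
  define y where "y j = (if j = i then u i else z j)" for j
  define g where "g j = (if j = i then 1 - (\<Sum>k\<in>N - {i}. a k) else a j)" for j
  have "(\<Sum>j\<in>N. flux p (u i) (c i j)) = 0"
    using linear_sum[OF flux_linear, of p "u i" "c i" N] c_sum linear_0[OF flux_linear, of p "u i"] by simp
  then have "(\<Sum>j\<in>N. - (flux p (u j) (c i j) + flux p (u i) (c i j)) + ?d j *\<^sub>R (u j - u i)) =
      (\<Sum>j\<in>N. - (flux p (u j) (c i j) - flux p (u i) (c i j)) + ?d j *\<^sub>R (u j - u i))"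
    by (simp add: sum.distrib sum_subtractf sum_negf)
  also have "\<dots> = (\<Sum>j\<in>N - {i}. - (flux p (u j) (c i j) - flux p (u i) (c i j)) + ?d j *\<^sub>R (u j - u i))"
    by (subst sum.remove[OF fin i]) simp
  also have "\<dots> = (\<Sum>j\<in>N - {i}. (2 * ?d j) *\<^sub>R (z j - u i))"
    by (simp only: z(3))
  finally have "m *\<^sub>R u1 = m *\<^sub>R u i + \<tau> *\<^sub>R (\<Sum>j\<in>N - {i}. (2 * ?d j) *\<^sub>R (z j - u i))"
    using upd by simp
  then have "(1 / m) *\<^sub>R (m *\<^sub>R u1) = (1 / m) *\<^sub>R (m *\<^sub>R u i + \<tau> *\<^sub>R (\<Sum>j\<in>N - {i}. (2 * ?d j) *\<^sub>R (z j - u i)))"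
    by simp
  then have "u1 = u i + (\<Sum>j\<in>N - {i}. a j *\<^sub>R (z j - u i))"
    using m by (simp add: scaleR_add_right scaleR_sum_right a_def)
  also have "\<dots> = (\<Sum>j\<in>N. g j *\<^sub>R y j)"
    by (subst sum.remove[OF fin i])
       (simp add: g_def y_def scaleR_diff_right scaleR_diff_left sum_subtractf scaleR_sum_left)
  also have "\<dots> \<in> A_set b"
  proof (rule convex_sum[OF fin convex_A_set])
    show "sum g N = 1"
      by (subst sum.remove[OF fin i]) (simp add: g_def)
    have "(\<Sum>k\<in>N - {i}. a k) = \<tau> * (2 / m * (\<Sum>j\<in>N - {i}. ?d j))"
      by (simp add: a_def sum_distrib_left)
    with CFL have "(\<Sum>k\<in>N - {i}. a k) \<le> 1" by simp
    then show "0 \<le> g j" for j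
      using z(2)[of j] m tau by (simp add: g_def a_def)
    show "y j \<in> A_set b" for j using adm z(1) by (simp add: y_def)
  qed
  finally show ?thesis .
qed

text \<open>The viscous terms are skew in \<open>i\<close> and \<open>j\<close>, and so are the flux terms unless both indices lie
  on the boundary.\<close>

lemma update_balance:
  fixes c :: "'v::finite \<Rightarrow> 'v \<Rightarrow> real^'d::finite" and u u1 :: "'v \<Rightarrow> 'd state"
  assumes part: "Vint \<union> Vbd = UNIV" "Vint \<inter> Vbd = {}"
    and st: "\<And>i j. j \<in> st i \<longleftrightarrow> i \<in> st j"
    and skew: "\<And>i j. i \<in> Vint \<or> j \<in> Vint \<Longrightarrow> c i j = - c j i"
    and upd: "\<And>i. m i *\<^sub>R u1 i = m i *\<^sub>R u i + \<tau> *\<^sub>R (\<Sum>j\<in>st i.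
      - (flux p (u j) (c i j) + flux p (u i) (c i j)) + d1 lam c u i j *\<^sub>R (u j - u i))"
  shows "(\<Sum>i\<in>UNIV. m i *\<^sub>R u1 i) = (\<Sum>i\<in>UNIV. m i *\<^sub>R u i) -
    \<tau> *\<^sub>R (\<Sum>i\<in>Vbd. \<Sum>j\<in>st i \<inter> Vbd. flux p (u j) (c i j) + flux p (u i) (c i j))"
proof -
  let ?f = "\<lambda>i j. flux p (u j) (c i j) + flux p (u i) (c i j)"
  let ?fb = "\<lambda>i j. if i \<in> Vbd \<and> j \<in> Vbd then ?f i j else 0"
  have "(\<Sum>i\<in>UNIV. \<Sum>j\<in>st i. ?f i j - ?fb i j) = 0"
  proof (rule sum_stencil_skew[OF st])
    show "?f i j - ?fb i j = - (?f j i - ?fb j i)" for i j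
    proof (cases "i \<in> Vbd \<and> j \<in> Vbd")
      case False
      then have "c i j = - c j i" using part skew by blast
      with False show ?thesis by (auto simp: linear_neg[OF flux_linear])
    qed simp
  qed
  then have "(\<Sum>i\<in>UNIV. \<Sum>j\<in>st i. ?f i j) = (\<Sum>i\<in>UNIV. \<Sum>j\<in>st i. ?fb i j)"
    by (simp add: sum_subtractf)
  also have "\<dots> = (\<Sum>i\<in>UNIV. if i \<in> Vbd then \<Sum>j\<in>st i \<inter> Vbd. ?f i j else 0)"
    by (intro sum.cong refl) (auto simp: sum.inter_restrict)
  also have "\<dots> = (\<Sum>i\<in>Vbd. \<Sum>j\<in>st i \<inter> Vbd. ?f i j)"
    by (simp add: sum.If_cases)
  finally have F: "(\<Sum>i\<in>UNIV. \<Sum>j\<in>st i. ?f i j) = (\<Sum>i\<in>Vbd. \<Sum>j\<in>st i \<inter> Vbd. ?f i j)" .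
  have D: "(\<Sum>i\<in>UNIV. \<Sum>j\<in>st i. d1 lam c u i j *\<^sub>R (u j - u i)) = 0"
    by (rule sum_stencil_skew[OF st]) (subst d1_sym, simp add: algebra_simps)
  have "(\<Sum>i\<in>UNIV. m i *\<^sub>R u1 i) = (\<Sum>i\<in>UNIV. m i *\<^sub>R u i) +
      \<tau> *\<^sub>R (\<Sum>i\<in>UNIV. \<Sum>j\<in>st i. - ?f i j + d1 lam c u i j *\<^sub>R (u j - u i))"
    by (simp only: upd sum.distrib scaleR_sum_right[symmetric])
  also have "(\<Sum>i\<in>UNIV. \<Sum>j\<in>st i. - ?f i j + d1 lam c u i j *\<^sub>R (u j - u i)) =
      - (\<Sum>i\<in>UNIV. \<Sum>j\<in>st i. ?f i j) + (\<Sum>i\<in>UNIV. \<Sum>j\<in>st i. d1 lam c u i j *\<^sub>R (u j - u i))"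
    by (simp only: sum.distrib sum_negf)
  finally show ?thesis by (simp add: D F)
qed

theorem lemma5p1:
  fixes b \<tau> :: real
    and p :: "('d::finite) state \<Rightarrow> real"
    and Vint Vbd :: "('v::finite) set"
    and st :: "'v \<Rightarrow> 'v set"
    and m :: "'v \<Rightarrow> real"
    and M :: "real^'v^'v"
    and c :: "'v \<Rightarrow> 'v \<Rightarrow> real^'d"
    and lam :: "real^'d \<Rightarrow> 'd state \<Rightarrow> 'd state \<Rightarrow> real"
    and u u1 :: "'v \<Rightarrow> 'd state"
  assumes dim: "CARD('d) \<in> {1, 2, 3}"
    and b: "0 \<le> b"
    and p_pos: "\<And>z. z \<in> B_set b \<Longrightarrow> 0 < p z"
    and partition: "Vint \<union> Vbd = UNIV" "Vint \<inter> Vbd = {}"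
    and stencil: "\<And>i. i \<in> st i" "\<And>i j. j \<in> st i \<longleftrightarrow> i \<in> st j"
    and mass_pos: "\<And>i. 0 < m i"
    and mass_matrix: "invertible M" "transpose M = M"
      "\<And>i j. j \<notin> st i \<Longrightarrow> M $ i $ j = 0"
      "\<And>i. m i = (\<Sum>j\<in>st i. M $ j $ i)"
    and c_stencil: "\<And>i j. j \<notin> st i \<Longrightarrow> c i j = 0"
    and c_skew: "\<And>i j. i \<in> Vint \<or> j \<in> Vint \<Longrightarrow> c i j = - c j i"
    and c_sum: "\<And>i. (\<Sum>j\<in>st i. c i j) = 0"
    and lam: "\<And>n uL uR. norm n = 1 \<Longrightarrow> uL \<in> B_set b \<Longrightarrow> uR \<in> B_set b \<Longrightarrow>
      0 < lam n uL uR \<and> max_wave_speed_bound b n (Theta b p uL) (Theta b p uR) (lam n uL uR)"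
    and tau: "0 < \<tau>"
    and update: "\<And>i. m i *\<^sub>R u1 i = m i *\<^sub>R u i + \<tau> *\<^sub>R (\<Sum>j\<in>st i.
      - (flux p (u j) (c i j) + flux p (u i) (c i j)) + d1 lam c u i j *\<^sub>R (u j - u i))"
    and u_adm: "\<And>i. u i \<in> A_set b"
    and CFL: "\<tau> * (MAX i. 2 / m i * (\<Sum>j\<in>st i - {i}. d1 lam c u i j)) \<le> 1"
  shows "(\<forall>i. u1 i \<in> A_set b) \<and>
    (let F = (\<Sum>i\<in>Vbd. \<Sum>j\<in>st i \<inter> Vbd. flux p (u j) (c i j) + flux p (u i) (c i j)) in
      rho F = 0 \<and> mom F = 0 \<and> Em F + Er F = 0 \<longrightarrow>
        (\<Sum>i\<in>UNIV. m i * rho (u1 i)) = (\<Sum>i\<in>UNIV. m i * rho (u i)) \<and>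
        (\<Sum>i\<in>UNIV. m i *\<^sub>R mom (u1 i)) = (\<Sum>i\<in>UNIV. m i *\<^sub>R mom (u i)) \<and>
        (\<Sum>i\<in>UNIV. m i * Etot (u1 i)) = (\<Sum>i\<in>UNIV. m i * Etot (u i)))"
proof -
  have "u1 i \<in> A_set b" for i
  proof (rule update_admissible[OF _ stencil(1) mass_pos tau c_sum p_pos lam update u_adm])
    let ?s = "\<lambda>i. 2 / m i * (\<Sum>j\<in>st i - {i}. d1 lam c u i j)"
    have "?s i \<le> (MAX i. ?s i)" by (intro Max_ge) auto
    then have "\<tau> * ?s i \<le> \<tau> * (MAX i. ?s i)" using tau by (intro mult_left_mono) auto
    then show "\<tau> * ?s i \<le> 1" using CFL by linarith
  qed auto
  moreover have "(\<Sum>i\<in>UNIV. m i * rho (u1 i)) = (\<Sum>i\<in>UNIV. m i * rho (u i)) \<and>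
        (\<Sum>i\<in>UNIV. m i *\<^sub>R mom (u1 i)) = (\<Sum>i\<in>UNIV. m i *\<^sub>R mom (u i)) \<and>
        (\<Sum>i\<in>UNIV. m i * Etot (u1 i)) = (\<Sum>i\<in>UNIV. m i * Etot (u i))"
    if F: "F = (\<Sum>i\<in>Vbd. \<Sum>j\<in>st i \<inter> Vbd. flux p (u j) (c i j) + flux p (u i) (c i j))"
      and F0: "rho F = 0" "mom F = 0" "Em F + Er F = 0" for F
  proof -
    have bal: "(\<Sum>i\<in>UNIV. m i *\<^sub>R u1 i) = (\<Sum>i\<in>UNIV. m i *\<^sub>R u i) - \<tau> *\<^sub>R F"
      unfolding F by (rule update_balance[OF partition stencil(2) c_skew update])
    have *: "(\<Sum>i\<in>UNIV. m i *\<^sub>R \<phi> (u1 i)) = (\<Sum>i\<in>UNIV. m i *\<^sub>R \<phi> (u i))"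
      if "linear \<phi>" "\<phi> F = 0" for \<phi> :: "'d state \<Rightarrow> 'x::real_vector"
      using arg_cong[OF bal, of \<phi>] that(2)
      by (simp add: linear_sum[OF that(1)] linear_diff[OF that(1)] linear_scale[OF that(1)])
    show ?thesis
      using *[OF rho_linear] *[OF mom_linear] *[OF Etot_linear] F0 by (simp add: Etot_def)
  qed
  ultimately show ?thesis unfolding Let_def by blast
qed

end
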